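(* Let $A\in\mathbb{C}^{n\times n}$ be a Hermitian matrix, let $\mathcal{X}$ be the eigenspace of $A$ associated with an eigenvalue $\lambda$, let $\mathcal{K}\subseteq\mathbb{C}^n$ be a nonzero subspace, and let $\sigma\in\mathbb{R}$ with $\sigma\notin\Lambda(A)$. Let $\mathcal{V}$ be a subspace spanned by (linearly independent) harmonic Ritz vectors associated with harmonic Ritz values $\Theta_k=\{\theta_1,\theta_2,\ldots,\theta_k\}$ with respect to $\mathcal{K}$ and the shift $\sigma$. Let $\Theta$ be the set of all harmonic Ritz values (repeated according to multiplicity) and let $P_{\mathcal{Q}}$ be the orthogonal projector onto $\mathcal{Q}=(A-\sigma I)\mathcal{K}$. Then $$\sin\angle(\mathcal{X},\mathcal{V})\le \kappa(A-\sigma I)\sqrt{1+\frac{\gamma^2}{\delta^2}}\;\sin\angle(\mathcal{X},\mathcal{K}),$$ where $\gamma=\|P_{\mathcal{Q}}(A-\sigma I)^{-1}(I-P_{\mathcal{Q}})\|_F$, $$\kappa(A-\sigma I)=\frac{\max_{\lambda_j\in\Lambda(A)}|\lambda_j-\sigma|}{\min_{\lambda_j\in\Lambda(A)}|\lambda_j-\sigma|},\qquad \delta=\min_{\theta_j\in\Theta\setminus\Theta_k}\left|\frac{\theta_j-\lambda}{(\lambda-\sigma)(\theta_j-\sigma)}\right|.$$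
   Context: $\Lambda(A)$ is the spectrum of $A$ and $\|\cdot\|_F$ is the Frobenius norm. For nonzero vectors, $\angle(x,y)\in[0,\pi/2]$ is defined by $\cos\angle(x,y)=|x^*y|/(\|x\|\|y\|)$. The angle between two nonzero subspaces is $\angle(\mathcal{X},\mathcal{Y})=\min_{x\in\mathcal{X},\,x\ne0;\;y\in\mathcal{Y},\,y\neq0}\angle(x,y)$. Harmonic Ritz pairs: let $K$ be a matrix whose columns form a basis of $\mathcal{K}$, $s=\dim\mathcal{K}$. Consider the $s\times s$ eigenvalue problem $K^*(A-\sigma I)^2Kc=\xi\,K^*(A-\sigma I)Kc$, $c\neq0$. Each eigenpair $(\xi,c)$ gives a harmonic Ritz pair $(\theta,v)$ with harmonic Ritz value $\theta=\xi+\sigma$ and harmonic Ritz vector $v=Kc$ (equivalently, $v\in\mathcal{K}$, $v\ne 0$, and $Av-\theta v\perp(A-\sigma I)\mathcal{K}$). $\mathcal{V}=\mathrm{span}\{v_1,\dots,v_k\}$, $k\ge1$, where $(\theta_i,v_i)$ are harmonic Ritz pairs and $v_1,\dots,v_k$ are linearly independent. $\Theta$ and $\Theta_k$ are multisets: $\Theta$ lists all $s$ harmonic Ritz values with multiplicity, and $\Theta\setminus\Theta_k$ is the multiset difference. If $K^*(A-\sigma I)K$ is singular, the corresponding infinite eigenvalues $\xi=\infty$ are counted as harmonic Ritz values $\theta_j=\infty$, and the corresponding term in $\delta$ is read as its limit $1/|\lambda-\sigma|$. If $\Theta\setminus\Theta_k$ is empty, $\delta=+\infty$ and $\gamma^2/\delta^2=0$;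 if $\delta=0$, the right-hand side is read as $+\infty$ (no assertion is made). *)

theory Defs
  imports "HOL-Analysis.Analysis" "HOL-Computational_Algebra.Polynomial"
begin

definition ctranspose :: "complex^'n^'m \<Rightarrow> complex^'m^'n" where
  "ctranspose A = (\<chi> i j. cnj (A $ j $ i))"

definition hermitian :: "complex^'n^'n \<Rightarrow> bool" where
  "hermitian A \<longleftrightarrow> ctranspose A = A"

definition cinner :: "complex^'n \<Rightarrow> complex^'n \<Rightarrow> complex" where
  "cinner x y = (\<Sum>i\<in>UNIV. cnj (x $ i) * y $ i)"

definition eigenspace :: "complex^'n^'n \<Rightarrow> complex \<Rightarrow> (complex^'n) set" where
  "eigenspace A lam = {x. A *v x = lam *s x}"

definition spectrum :: "complex^'n^'n \<Rightarrow> complex set" where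
  "spectrum A = {lam. \<exists>x. x \<noteq> 0 \<and> A *v x = lam *s x}"

definition frobenius_norm :: "complex^'n^'m \<Rightarrow> real" where
  "frobenius_norm B = sqrt (\<Sum>i\<in>UNIV. \<Sum>j\<in>UNIV. (cmod (B $ i $ j))\<^sup>2)"

definition vector_angle :: "complex^'n \<Rightarrow> complex^'n \<Rightarrow> real" where
  "vector_angle x y = arccos (cmod (cinner x y) / (norm x * norm y))"

text \<open>For nonzero subspaces the infimum is attained (the unit spheres are compact), so it is
  the minimal angle.\<close>

definition subspace_angle :: "(complex^'n) set \<Rightarrow> (complex^'n) set \<Rightarrow> real" where
  "subspace_angle X Y = Inf {vector_angle x y | x y. x \<in> X \<and> x \<noteq> 0 \<and> y \<in> Y \<and> y \<noteq> 0}"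

definition orthogonal_projector :: "complex^'n^'n \<Rightarrow> (complex^'n) set \<Rightarrow> bool" where
  "orthogonal_projector P Q \<longleftrightarrow> P ** P = P \<and> ctranspose P = P \<and> range (\<lambda>x. P *v x) = Q"

definition shifted :: "complex^'n^'n \<Rightarrow> real \<Rightarrow> complex^'n^'n" where
  "shifted A \<sigma> = A - mat (complex_of_real \<sigma>)"

definition shifted_cond :: "complex^'n^'n \<Rightarrow> real \<Rightarrow> real" where
  "shifted_cond A \<sigma> =
     Max ((\<lambda>\<mu>. cmod (\<mu> - complex_of_real \<sigma>)) ` spectrum A) /
     Min ((\<lambda>\<mu>. cmod (\<mu> - complex_of_real \<sigma>)) ` spectrum A)"

definition basis_matrix :: "complex^'s^'n \<Rightarrow> (complex^'n) set \<Rightarrow> bool" where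
  "basis_matrix K W \<longleftrightarrow>
     inj (\<lambda>j. column j K) \<and> vec.independent (columns K) \<and> vec.span (columns K) = W"

definition pencil_lhs :: "complex^'n^'n \<Rightarrow> real \<Rightarrow> complex^'s^'n \<Rightarrow> complex^'s^'s" where
  "pencil_lhs A \<sigma> K = ctranspose K ** (shifted A \<sigma> ** shifted A \<sigma>) ** K"

definition pencil_rhs :: "complex^'n^'n \<Rightarrow> real \<Rightarrow> complex^'s^'n \<Rightarrow> complex^'s^'s" where
  "pencil_rhs A \<sigma> K = ctranspose K ** shifted A \<sigma> ** K"

text \<open>Harmonic Ritz values live in the complex numbers extended by one infinite value.\<close>

datatype ritz_value = Fin_Ritz complex | Inf_Ritz

text \<open>An eigenvector of the pencil for the eigenvalue \<open>\<infinity>\<close> is a nonzero kernel vector of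
  the right-hand matrix.\<close>

fun harmonic_ritz_pair ::
  "complex^'n^'n \<Rightarrow> real \<Rightarrow> complex^'s^'n \<Rightarrow> ritz_value \<Rightarrow> complex^'n \<Rightarrow> bool" where
  "harmonic_ritz_pair A \<sigma> K (Fin_Ritz \<theta>) v \<longleftrightarrow>
     (\<exists>\<xi> c. c \<noteq> 0 \<and> pencil_lhs A \<sigma> K *v c = \<xi> *s (pencil_rhs A \<sigma> K *v c) \<and>
        \<theta> = \<xi> + complex_of_real \<sigma> \<and> v = K *v c)"
| "harmonic_ritz_pair A \<sigma> K Inf_Ritz v \<longleftrightarrow>
     (\<exists>c. c \<noteq> 0 \<and> pencil_rhs A \<sigma> K *v c = 0 \<and> v = K *v c)"

text \<open>The polynomial \<open>det (M - x N)\<close> in \<open>x\<close>, where \<open>M\<close> and \<open>N\<close> are the two matrices of the pencil.\<close>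

definition pencil_poly :: "complex^'n^'n \<Rightarrow> real \<Rightarrow> complex^'s^'n \<Rightarrow> complex poly" where
  "pencil_poly A \<sigma> K =
     det (\<chi> i j. [:pencil_lhs A \<sigma> K $ i $ j, - (pencil_rhs A \<sigma> K $ i $ j):])"

text \<open>Finite eigenvalues of the pencil are counted with their multiplicity as roots; the eigenvalue
  \<open>\<infinity>\<close> has the degree defect as its multiplicity, which makes \<open>CARD('s)\<close> values in total.\<close>

definition harmonic_ritz_values ::
  "complex^'n^'n \<Rightarrow> real \<Rightarrow> complex^'s^'n \<Rightarrow> ritz_value multiset" where
  "harmonic_ritz_values A \<sigma> K =
     image_mset (\<lambda>\<xi>. Fin_Ritz (\<xi> + complex_of_real \<sigma>)) (proots (pencil_poly A \<sigma> K)) +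
     replicate_mset (CARD('s) - degree (pencil_poly A \<sigma> K)) Inf_Ritz"

fun gap_term :: "complex \<Rightarrow> real \<Rightarrow> ritz_value \<Rightarrow> real" where
  "gap_term lam \<sigma> (Fin_Ritz \<theta>) =
     cmod ((\<theta> - lam) / ((lam - complex_of_real \<sigma>) * (\<theta> - complex_of_real \<sigma>)))"
| "gap_term lam \<sigma> Inf_Ritz = 1 / cmod (lam - complex_of_real \<sigma>)"

text \<open>Extended real valued, so that the gap of the empty multiset is \<open>\<infinity>\<close>.\<close>

definition ritz_gap :: "complex \<Rightarrow> real \<Rightarrow> ritz_value multiset \<Rightarrow> ereal" where
  "ritz_gap lam \<sigma> D = (INF t\<in>set_mset D. ereal (gap_term lam \<sigma> t))"

end

theory Submission
  imports Defs
begin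

text \<open>With \<open>M = A - \<sigma> I\<close> and \<open>Q = M K\<close>, harmonic Ritz pairs \<open>(\<theta>, v)\<close> of \<open>A\<close> on \<open>K\<close> are the ordinary Ritz pairs
  \<open>(1 / (\<theta> - \<sigma>), M v)\<close> of \<open>C = M\<close>-inverse on \<open>Q\<close>, and \<open>X\<close> lies in the eigenspace of \<open>C\<close> for
  \<open>\<tau> = 1 / (\<lambda> - \<sigma>)\<close>. Let \<open>x\<close> be an eigenvector and write \<open>P x = u + z\<close> with \<open>u\<close> in \<open>U = M V\<close> and \<open>z\<close> in
  the complement \<open>Z\<close> of \<open>U\<close> in \<open>Q\<close>. Both parts are invariant under the Hermitian compression
  \<open>P C P\<close>, whose eigenvalues on \<open>Z\<close> are the remaining Ritz values. Projecting
  \<open>(P C P - \<tau>) P x = - P C (x - P x)\<close> onto \<open>Z\<close> gives \<open>\<delta> |z| \<le> \<gamma> |x - P x|\<close>, so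
  \<open>|x - u| \<le> sqrt (1 + (\<gamma> / \<delta>)^2) |x - P x|\<close>. Passing from \<open>K\<close> to \<open>Q\<close> by \<open>M\<close> costs a factor
  \<open>max |\<lambda>\<^sub>j - \<sigma>| / |\<lambda> - \<sigma>|\<close>, and passing back from \<open>U\<close> to \<open>V\<close> a factor \<open>|\<lambda> - \<sigma>| / min |\<lambda>\<^sub>j - \<sigma>|\<close>;
  the product is the condition number.\<close>

subsection \<open>Hermitian matrices and orthogonal eigenbases\<close>

lemma cinner_add_right: "cinner x (y + z) = cinner x y + cinner x z"
  by (simp add: cinner_def algebra_simps sum.distrib)

lemma cinner_diff_right: "cinner x (y - z) = cinner x y - cinner x z"
  by (simp add: cinner_def algebra_simps sum_subtractf)

lemma cinner_diff_left: "cinner (x - y) z = cinner x z - cinner y z"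
  by (simp add: cinner_def algebra_simps sum_subtractf)

lemma cinner_scale_right: "cinner x (c *s y) = c * cinner x y"
  by (simp add: cinner_def sum_distrib_left mult_ac)

lemma cinner_scale_left: "cinner (c *s x) y = cnj c * cinner x y"
  by (simp add: cinner_def sum_distrib_left mult_ac)

lemma cinner_zero [simp]: "cinner x 0 = 0" "cinner 0 x = 0"
  by (simp_all add: cinner_def)

lemma cnj_cinner: "cnj (cinner x y) = cinner y x"
  by (simp add: cinner_def mult.commute)

lemma cinner_sum_right: "cinner x (sum f S) = (\<Sum>i\<in>S. cinner x (f i))"
  by (induction S rule: infinite_finite_induct) (simp_all add: cinner_add_right)

lemma cinner_self: "cinner x x = complex_of_real ((norm x)\<^sup>2)"
proof -
  have "cinner x x = (\<Sum>i\<in>UNIV. complex_of_real ((cmod (x $ i))\<^sup>2))"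
    unfolding cinner_def by (intro sum.cong refl) (metis complex_norm_square mult.commute)
  also have "\<dots> = complex_of_real ((norm x)\<^sup>2)"
    by (simp add: norm_vec_def L2_set_def sum_nonneg)
  finally show ?thesis .
qed

lemma Re_cinner: "Re (cinner x y) = x \<bullet> y"
  by (simp add: cinner_def inner_vec_def inner_complex_def)

lemma cmod_cinner_le: "cmod (cinner x y) \<le> norm x * norm y"
proof -
  have "cmod (cinner x y) \<le> (\<Sum>i\<in>UNIV. cmod (x $ i) * cmod (y $ i))"
    unfolding cinner_def by (rule order_trans[OF norm_sum]) (simp add: norm_mult)
  also have "\<dots> \<le> norm x * norm y"
    unfolding norm_vec_def using L2_set_mult_ineq[of "\<lambda>i. cmod (x $ i)" "\<lambda>i. cmod (y $ i)" UNIV]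
    by simp
  finally show ?thesis .
qed

lemma cinner_adjoint: "cinner x (T *v y) = cinner (ctranspose T *v x) y"
proof -
  have "cinner x (T *v y) = (\<Sum>i\<in>UNIV. \<Sum>j\<in>UNIV. cnj (x $ i) * T $ i $ j * y $ j)"
    by (simp add: cinner_def matrix_vector_mult_def sum_distrib_left mult_ac)
  also have "\<dots> = (\<Sum>j\<in>UNIV. \<Sum>i\<in>UNIV. cnj (x $ i) * T $ i $ j * y $ j)"
    by (rule sum.swap)
  also have "\<dots> = cinner (ctranspose T *v x) y"
    by (simp add: cinner_def matrix_vector_mult_def ctranspose_def sum_distrib_right sum_distrib_left
        mult_ac)
  finally show ?thesis .
qed

lemma cinner_hermitian: "hermitian T \<Longrightarrow> cinner x (T *v y) = cinner (T *v x) y"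
  by (simp add: cinner_adjoint hermitian_def)

lemma norm_scale: "norm (c *s x) = cmod c * norm (x :: complex^'n)"
  by (simp add: norm_vec_def norm_mult L2_set_right_distrib)

lemma pythagoras:
  assumes "cinner x y = 0"
  shows "(norm (x + y))\<^sup>2 = (norm x)\<^sup>2 + (norm y)\<^sup>2"
proof -
  have "x \<bullet> y = 0" by (metis Re_cinner assms zero_complex.sel(1))
  then show ?thesis
    by (simp add: dot_norm)
qed

text \<open>Cauchy-Schwarz in each row, then the squares are summed over the rows. This is how the
  Frobenius norm in \<open>\<gamma>\<close> comes to bound a vector norm.\<close>

lemma norm_matrix_vector_le: "norm (B *v x) \<le> frobenius_norm B * norm x"
proof -
  have row: "cmod ((B *v x) $ i) \<le> norm (B $ i) * norm x" for i
  proof -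
    have "cmod ((B *v x) $ i) \<le> (\<Sum>j\<in>UNIV. cmod (B $ i $ j) * cmod (x $ j))"
      unfolding matrix_vector_mult_def vec_lambda_beta
      by (rule order_trans[OF norm_sum]) (simp add: norm_mult)
    also have "\<dots> \<le> norm (B $ i) * norm x"
      unfolding norm_vec_def
      using L2_set_mult_ineq[of "\<lambda>j. cmod (B $ i $ j)" "\<lambda>j. cmod (x $ j)" UNIV] by simp
    finally show ?thesis .
  qed
  have "norm (B *v x) \<le> L2_set (\<lambda>i. norm (B $ i) * norm x) UNIV"
    unfolding norm_vec_def[of "B *v x"] by (intro L2_set_mono row) auto
  also have "\<dots> = frobenius_norm B * norm x"
  proof -
    have "frobenius_norm B = L2_set (\<lambda>i. norm (B $ i)) UNIV"
      by (simp add: frobenius_norm_def L2_set_def norm_vec_def sum_nonneg)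
    then show ?thesis by (simp add: L2_set_left_distrib)
  qed
  finally show ?thesis .
qed

lemma scaleR_vec_scale: "r *\<^sub>R x = complex_of_real r *s (x :: complex^'n)"
  by (simp add: vec_eq_iff scaleR_conv_of_real[where 'a=complex])

text \<open>A complex subspace is in particular a real one, and finite-dimensional real subspaces
  are closed. This makes the unit sphere of the subspace compact.\<close>

lemma closed_vec_subspace:
  fixes Z :: "(complex^'n) set"
  assumes "vec.subspace Z"
  shows "closed Z"
proof (rule closed_subspace)
  show "subspace Z"
    using assms by (simp add: subspace_def vec.subspace_def scaleR_vec_scale)
qed

text \<open>The maximum of the Rayleigh quotient on the unit sphere of the subspace is an eigenvalue:
  the first-order term of the quotient at the maximiser vanishes in every direction.\<close>

lemma hermitian_eigenvector_exists:
  fixes T :: "complex^'n^'n"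
  assumes T: "hermitian T" and Z: "vec.subspace Z" "Z \<noteq> {0}"
    and inv: "\<And>z. z \<in> Z \<Longrightarrow> T *v z \<in> Z"
  obtains e \<mu> where "e \<in> Z" "e \<noteq> 0" "T *v e = \<mu> *s e"
proof -
  define R where "R z = z \<bullet> (T *v z)" for z
  define S where "S = Z \<inter> sphere 0 1"
  obtain z0 where z0: "z0 \<in> Z" "z0 \<noteq> 0"
    using Z vec.subspace_0 by blast
  have "(1 / norm z0) *\<^sub>R z0 \<in> S"
    using z0 Z by (simp add: S_def scaleR_vec_scale vec.subspace_scale norm_scale norm_divide)
  then have ne: "S \<noteq> {}" by blast
  have cpt: "compact S"
    unfolding S_def using closed_Int_compact[OF closed_vec_subspace[OF Z(1)] compact_sphere] .
  have lin: "linear ((*v) T)"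
    by (intro linearI) (simp_all add: matrix_vector_right_distrib scaleR_vec_scale vec.scale)
  have cont: "continuous_on S R"
    unfolding R_def by (intro continuous_intros linear_continuous_on linear_conv_bounded_linear[THEN iffD1] lin)
  obtain x where x: "x \<in> S" and mx: "\<And>y. y \<in> S \<Longrightarrow> R y \<le> R x"
    using continuous_attains_sup[OF cpt ne cont] by blast
  have xZ: "x \<in> Z" and nx: "norm x = 1" using x by (auto simp: S_def)
  define m where "m = R x"
  have R_scale: "R (r *\<^sub>R y) = r\<^sup>2 * R y" for r y
    by (simp add: R_def linear_scale[OF lin] power2_eq_square)
  \<comment> \<open>Homogeneity of degree 2 carries the maximum from the unit sphere to all of
    \<open>Z\<close>.\<close>
  have bound: "R y \<le> m * (norm y)\<^sup>2" if "y \<in> Z" for y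
  proof (cases "y = 0")
    case True then show ?thesis by (simp add: R_def)
  next
    case False
    then have "(1 / norm y) *\<^sub>R y \<in> S"
      using that Z by (simp add: S_def scaleR_vec_scale vec.subspace_scale norm_scale norm_divide)
    from mx[OF this] have "(1 / norm y)\<^sup>2 * R y \<le> m" unfolding R_scale m_def .
    then show ?thesis using False by (simp add: field_simps power2_eq_square)
  qed
  \<comment> \<open>\<open>d\<close> is the residual of the maximiser. It lies in \<open>Z\<close>,
    so \<open>x\<close> may be perturbed along it; maximality then yields an inequality between a
    linear and a quadratic term in \<open>t\<close>.\<close>
  define d where "d = T *v x - m *\<^sub>R x"
  have dZ: "d \<in> Z"
    unfolding d_def scaleR_vec_scale using inv xZ Z by (simp add: vec.subspace_diff vec.subspace_scale)
  have sym: "y \<bullet> (T *v z) = z \<bullet> (T *v y)" for y z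
    by (metis Re_cinner T cinner_hermitian inner_commute)
  have quad: "2 * t * (norm d)\<^sup>2 \<le> t\<^sup>2 * (m * (norm d)\<^sup>2 - R d)" for t
  proof -
    have "x + t *\<^sub>R d \<in> Z"
      using xZ dZ Z unfolding scaleR_vec_scale by (simp add: vec.subspace_add vec.subspace_scale)
    from bound[OF this]
    have "R (x + t *\<^sub>R d) \<le> m * (norm (x + t *\<^sub>R d))\<^sup>2" .
    moreover have "R (x + t *\<^sub>R d) = m + 2 * t * (d \<bullet> (T *v x)) + t\<^sup>2 * R d"
      using sym[of x d]
      by (simp add: R_def m_def linear_add[OF lin] linear_scale[OF lin] inner_add_left inner_add_right
          algebra_simps power2_eq_square)
    moreover have "(norm (x + t *\<^sub>R d))\<^sup>2 = 1 + 2 * t * (d \<bullet> x) + t\<^sup>2 * (norm d)\<^sup>2"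
    proof -
      have "x \<bullet> x = 1" using nx by (simp add: norm_eq_1)
      then show ?thesis unfolding power2_norm_eq_inner
        by (simp add: inner_add_left inner_add_right inner_commute algebra_simps power2_eq_square)
    qed
    moreover have "d \<bullet> (T *v x) = (norm d)\<^sup>2 + m * (d \<bullet> x)"
    proof -
      have "d \<bullet> (T *v x) = d \<bullet> (d + m *\<^sub>R x)" by (simp add: d_def)
      then show ?thesis by (simp add: inner_add_right power2_norm_eq_inner)
    qed
    ultimately show ?thesis by (simp add: algebra_simps)
  qed
  have "norm d = 0"
  proof (rule ccontr)
    assume "norm d \<noteq> 0"
    then have pos: "(norm d)\<^sup>2 > 0" by simp
    \<comment> \<open>\<open>c\<close> dominates the quadratic coefficient and is positive. The
      choice of \<open>t\<close> gives \<open>t * c = (norm d)\<^sup>2\<close>, which contradicts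
      \<open>2 * (norm d)\<^sup>2 \<le> t * c\<close>.\<close>
    define c where "c = \<bar>m * (norm d)\<^sup>2 - R d\<bar> + (norm d)\<^sup>2"
    define t where "t = (norm d)\<^sup>2 / c"
    have c: "c > 0" using pos unfolding c_def by linarith
    then have t: "t > 0" using pos by (simp add: t_def)
    have "2 * t * (norm d)\<^sup>2 \<le> t\<^sup>2 * c"
      using quad[of t] by (rule order_trans) (intro mult_left_mono; simp add: c_def add_increasing2)
    then have "2 * (norm d)\<^sup>2 \<le> t * c" using t by (simp add: power2_eq_square)
    then show False using c pos by (simp add: t_def)
  qed
  then have "T *v x = complex_of_real m *s x"
    by (simp add: d_def scaleR_vec_scale)
  with xZ nx show ?thesis by (intro that[of x]) auto
qed

text \<open>The vectors need not be normalised. Excluding 0 makes every member on which a matrix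
  acts by a scalar a genuine eigenvector.\<close>

definition orthogonal_basis :: "(complex^'n) set \<Rightarrow> (complex^'n) set \<Rightarrow> bool" where
  "orthogonal_basis E Z \<longleftrightarrow> finite E \<and> 0 \<notin> E \<and> vec.span E = Z \<and>
     (\<forall>e\<in>E. \<forall>f\<in>E. e \<noteq> f \<longrightarrow> cinner e f = 0)"

lemma cinner_zero_commute: "cinner x y = 0 \<longleftrightarrow> cinner y x = 0"
  by (metis cnj_cinner complex_cnj_zero)

text \<open>Induction on the dimension: one eigenvector is split off, and its orthogonal complement
  in \<open>Z\<close> is again invariant because \<open>T\<close> is Hermitian. The cardinality
  bound later yields independence by counting.\<close>

lemma hermitian_orthogonal_eigenbasis:
  fixes T :: "complex^'n^'n"
  assumes T: "hermitian T" and "vec.subspace Z" "\<And>z. z \<in> Z \<Longrightarrow> T *v z \<in> Z"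
  shows "\<exists>E. orthogonal_basis E Z \<and> card E \<le> vec.dim Z \<and> (\<forall>e\<in>E. \<exists>\<mu>. T *v e = \<mu> *s e)"
  using assms(2,3)
proof (induction "vec.dim Z" arbitrary: Z rule: less_induct)
  case less
  note Z = less.prems(1) and inv = less.prems(2)
  show ?case
  proof (cases "Z = {0}")
    case True
    then show ?thesis by (intro exI[of _ "{}"]) (simp add: orthogonal_basis_def)
  next
    case False
    obtain e \<mu> where e: "e \<in> Z" "e \<noteq> 0" "T *v e = \<mu> *s e"
      using hermitian_eigenvector_exists[OF T Z False inv] by blast
    define Y where "Y = {z \<in> Z. cinner e z = 0}"
    have Y: "vec.subspace Y"
      using Z by (auto simp: Y_def vec.subspace_def cinner_add_right cinner_scale_right)
    have YT: "T *v z \<in> Y" if "z \<in> Y" for z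
      using that inv T e(3) by (simp add: Y_def cinner_hermitian cinner_scale_left)
    have ee: "cinner e e \<noteq> 0" using e by (simp add: cinner_self)
    then have "Y \<subset> Z" using e by (auto simp: Y_def)
    then have dim: "vec.dim Y < vec.dim Z"
      using Y Z by (intro vec.dim_psubset) (simp add: vec.span_eq_iff[THEN iffD2])
    obtain E where E: "orthogonal_basis E Y" "card E \<le> vec.dim Y" "\<forall>e\<in>E. \<exists>\<mu>. T *v e = \<mu> *s e"
      using less.hyps[OF dim Y YT] by blast
    have EY: "E \<subseteq> Y" using E(1) vec.span_superset by (auto simp: orthogonal_basis_def)
    have "vec.span (insert e E) = Z"
    proof
      show "vec.span (insert e E) \<subseteq> Z"
        using Z EY e by (intro vec.span_minimal) (auto simp: Y_def)
      show "Z \<subseteq> vec.span (insert e E)"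
      proof
        fix z assume z: "z \<in> Z"
        define a where "a = cinner e z / cinner e e"
        have "z - a *s e \<in> Y"
          using z e Z ee
          by (simp add: Y_def vec.subspace_diff vec.subspace_scale cinner_diff_right
              cinner_scale_right a_def)
        then have "z - a *s e \<in> vec.span E" using E(1) by (simp add: orthogonal_basis_def)
        then show "z \<in> vec.span (insert e E)" by (auto simp: vec.span_insert)
      qed
    qed
    moreover have "cinner e f = 0 \<and> cinner f e = 0" if "f \<in> E" for f
      using that EY by (auto simp: Y_def cinner_zero_commute)
    ultimately have "orthogonal_basis (insert e E) Z"
      using E(1) e(2) by (auto simp: orthogonal_basis_def)
    moreover have "card (insert e E) \<le> vec.dim Z"
      using E(1,2) dim by (auto simp: orthogonal_basis_def card_insert_if)
    ultimately show ?thesis using E(3) e(3) by (intro exI[of _ "insert e E"]) auto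
  qed
qed

lemma norm_sum_orthogonal:
  fixes E :: "(complex^'n) set"
  assumes "finite E" and "\<forall>e\<in>E. \<forall>f\<in>E. e \<noteq> f \<longrightarrow> cinner e f = 0"
  shows "(norm (\<Sum>e\<in>E. a e *s e))\<^sup>2 = (\<Sum>e\<in>E. (cmod (a e) * norm e)\<^sup>2)"
  using assms
proof (induction E rule: finite_induct)
  case empty then show ?case by simp
next
  case (insert x F)
  have "cinner (a x *s x) (\<Sum>e\<in>F. a e *s e) = 0"
    using insert by (auto simp: cinner_sum_right cinner_scale_left cinner_scale_right intro!: sum.neutral)
  from pythagoras[OF this] show ?case using insert by (simp add: norm_scale)
qed

text \<open>In orthogonal eigenvector coordinates \<open>T - \<tau>\<close> is diagonal, so each
  squared coordinate length is scaled by the square of \<open>cmod (ev e - \<tau>)\<close> and the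
  bounds hold term by term.\<close>

lemma eigenbasis_norm_bounds:
  fixes T :: "complex^'n^'n"
  assumes E: "orthogonal_basis E Z" and ev: "\<And>e. e \<in> E \<Longrightarrow> T *v e = ev e *s e" and z: "z \<in> Z"
  shows "0 \<le> lo \<Longrightarrow> (\<And>e. e \<in> E \<Longrightarrow> lo \<le> cmod (ev e - \<tau>)) \<Longrightarrow> lo * norm z \<le> norm (T *v z - \<tau> *s z)"
    and "0 \<le> hi \<Longrightarrow> (\<And>e. e \<in> E \<Longrightarrow> cmod (ev e - \<tau>) \<le> hi) \<Longrightarrow> norm (T *v z - \<tau> *s z) \<le> hi * norm z"
proof -
  have fin: "finite E" and orth: "\<forall>e\<in>E. \<forall>f\<in>E. e \<noteq> f \<longrightarrow> cinner e f = 0"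
    using E by (auto simp: orthogonal_basis_def)
  obtain a where a: "z = (\<Sum>e\<in>E. a e *s e)"
    using z E fin by (auto simp: orthogonal_basis_def vec.span_finite)
  have "T *v z - \<tau> *s z = (\<Sum>e\<in>E. (a e * (ev e - \<tau>)) *s e)"
    unfolding a vec.sum vec.scale_sum_right sum_subtractf[symmetric]
    by (intro sum.cong refl) (simp add: vec.scale ev vec_eq_iff algebra_simps)
  then have 1: "(norm (T *v z - \<tau> *s z))\<^sup>2 = (\<Sum>e\<in>E. (cmod (ev e - \<tau>) * (cmod (a e) * norm e))\<^sup>2)"
    using norm_sum_orthogonal[OF fin orth] by (simp add: norm_mult mult_ac)
  have 2: "(c * norm z)\<^sup>2 = (\<Sum>e\<in>E. (c * (cmod (a e) * norm e))\<^sup>2)" for c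
    unfolding a using norm_sum_orthogonal[OF fin orth, of a]
    by (simp add: power_mult_distrib sum_distrib_left)
  show "lo * norm z \<le> norm (T *v z - \<tau> *s z)"
    if "0 \<le> lo" "\<And>e. e \<in> E \<Longrightarrow> lo \<le> cmod (ev e - \<tau>)"
    by (rule power2_le_imp_le, unfold 1 2, intro sum_mono power_mono mult_right_mono that(2))
      (use that in auto)
  show "norm (T *v z - \<tau> *s z) \<le> hi * norm z"
    if "0 \<le> hi" "\<And>e. e \<in> E \<Longrightarrow> cmod (ev e - \<tau>) \<le> hi"
    by (rule power2_le_imp_le, unfold 1 2, intro sum_mono power_mono mult_right_mono that(2))
      (use that in auto)
qed

subsection \<open>Eigenvalues of the pencil\<close>

text \<open>The harmonic Ritz value belonging to the eigenvalue \<open>\<mu>\<close> of the inverted problem.\<close>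

definition ritz_of :: "real \<Rightarrow> complex \<Rightarrow> ritz_value" where
  "ritz_of \<sigma> \<mu> = (if \<mu> = 0 then Inf_Ritz else Fin_Ritz (1 / \<mu> + complex_of_real \<sigma>))"

lemma proots_reciprocal_factor:
  fixes \<mu> :: complex
  assumes "\<mu> \<noteq> 0"
  shows "proots [:1, - \<mu>:] = {#1 / \<mu>#}"
proof -
  have "[:1, - \<mu>:] = smult (- \<mu>) [:- (1 / \<mu>), 1:]" using assms by simp
  then show ?thesis using assms by (metis neg_equal_0_iff_equal proots_smult proots_linear_factor minus_minus)
qed

text \<open>A factor with \<open>\<mu> j \<noteq> 0\<close> contributes the root
  \<open>1 / \<mu> j\<close>; one with \<open>\<mu> j = 0\<close> is the constant 1 and adds to the
  degree defect, hence one infinite value. The degree bound keeps the truncated subtraction exact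
  during the induction.\<close>

lemma proots_reciprocal_prod:
  fixes \<mu> :: "'a \<Rightarrow> complex"
  assumes "finite J"
  defines "p \<equiv> \<lambda>J. \<Prod>j\<in>J. [:1, - \<mu> j:]"
  shows "degree (p J) \<le> card J \<and>
    image_mset (\<lambda>\<xi>. Fin_Ritz (\<xi> + complex_of_real \<sigma>)) (proots (p J)) +
      replicate_mset (card J - degree (p J)) Inf_Ritz =
    image_mset (\<lambda>j. ritz_of \<sigma> (\<mu> j)) (mset_set J)"
  using assms(1)
proof (induction J rule: finite_induct)
  case empty then show ?case by (simp add: p_def)
next
  case (insert x F)
  have nz: "p F \<noteq> 0" using insert(1) by (simp add: p_def)
  have step: "p (insert x F) = [:1, - \<mu> x:] * p F"
    using insert by (simp add: p_def)
  show ?case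
  proof (cases "\<mu> x = 0")
    case True
    then have "p (insert x F) = p F" unfolding step by simp
    then show ?thesis
      using insert True by (auto simp: ritz_of_def Suc_diff_le)
  next
    case False
    have "degree (p (insert x F)) = Suc (degree (p F))"
      unfolding step using nz False by (subst degree_mult_eq) auto
    moreover have "proots (p (insert x F)) = add_mset (1 / \<mu> x) (proots (p F))"
      unfolding step using nz False by (subst proots_mult) (auto simp: proots_reciprocal_factor)
    ultimately show ?thesis using insert False by (auto simp: ritz_of_def)
  qed
qed

lemma poly_det: "poly (det M) x = det (\<chi> i j. poly (M $ i $ j) x)"
  by (simp add: det_def poly_sum poly_prod)

text \<open>The columns of \<open>S\<close> diagonalise the pencil, so its determinant is a nonzero
  constant times the product of the factors \<open>1 - x * \<mu> j\<close>. Algebraic multiplicities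
  are thereby read off from eigenvectors.\<close>

lemma harmonic_ritz_values_pencil_eigenbasis:
  fixes A :: "complex^'n^'n" and K :: "complex^'s^'n" and S :: "complex^'s^'s"
  assumes L: "det (pencil_lhs A \<sigma> K) \<noteq> 0" and S: "det S \<noteq> 0"
    and ev: "\<And>j. pencil_rhs A \<sigma> K *v column j S = \<mu> j *s (pencil_lhs A \<sigma> K *v column j S)"
  shows "harmonic_ritz_values A \<sigma> K = image_mset (\<lambda>j. ritz_of \<sigma> (\<mu> j)) (mset_set UNIV)"
proof -
  let ?L = "pencil_lhs A \<sigma> K" and ?R = "pencil_rhs A \<sigma> K"
  have col: "(M ** S) $ i $ j = (M *v column j S) $ i" for M :: "complex^'s^'s" and i j
    by (simp add: matrix_matrix_mult_def matrix_vector_mult_def column_def)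
  \<comment> \<open>The polynomial identity is proved at every point \<open>x\<close>, where it
    concerns determinants of complex matrices, and \<open>det S\<close> can be cancelled.\<close>
  have "poly (pencil_poly A \<sigma> K) x = poly (smult (det ?L) (\<Prod>j\<in>UNIV. [:1, - \<mu> j:])) x" for x
  proof -
    have "poly (pencil_poly A \<sigma> K) x = det (?L - (\<chi> i j. x * ?R $ i $ j))"
      unfolding pencil_poly_def poly_det by (rule arg_cong[of _ _ det]) (simp add: vec_eq_iff)
    moreover have "(?L - (\<chi> i j. x * ?R $ i $ j)) ** S =
        ?L ** S ** (\<chi> i j. if i = j then 1 - x * \<mu> j else 0)"
    proof -
      have "((?L - (\<chi> i j. x * ?R $ i $ j)) ** S) $ i $ j = (?L ** S) $ i $ j * (1 - x * \<mu> j)" for i j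
      proof -
        have "((?L - (\<chi> i j. x * ?R $ i $ j)) ** S) $ i $ j = (?L ** S) $ i $ j - x * (?R ** S) $ i $ j"
          by (simp add: matrix_matrix_mult_def sum_subtractf sum_distrib_left algebra_simps)
        also have "(?R ** S) $ i $ j = \<mu> j * (?L ** S) $ i $ j"
          unfolding col ev by simp
        finally show ?thesis by (simp add: algebra_simps)
      qed
      moreover have "(?L ** S ** (\<chi> i j. if i = j then 1 - x * \<mu> j else 0)) $ i $ j =
          (?L ** S) $ i $ j * (1 - x * \<mu> j)" for i j
        by (simp add: matrix_matrix_mult_def[of "?L ** S"] if_distrib[of "\<lambda>u. _ * u"] cong: if_cong)
      ultimately show ?thesis by (simp add: vec_eq_iff)
    qed
    then have "det (?L - (\<chi> i j. x * ?R $ i $ j)) * det S = det ?L * det S * (\<Prod>j\<in>UNIV. 1 - x * \<mu> j)"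
      by (simp add: det_mul[symmetric] det_diagonal[symmetric])
         (simp add: det_mul det_diagonal)
    ultimately show ?thesis using S by (simp add: poly_prod mult_ac)
  qed
  then have eq: "pencil_poly A \<sigma> K = smult (det ?L) (\<Prod>j\<in>UNIV. [:1, - \<mu> j:])"
    by (simp add: poly_eq_poly_eq_iff[symmetric] fun_eq_iff)
  show ?thesis
    using proots_reciprocal_prod[of "UNIV :: 's set" \<mu> \<sigma>] L
    by (simp add: harmonic_ritz_values_def eq)
qed

lemma matrix_vector_eq_sum_columns: "B *v x = (\<Sum>j\<in>UNIV. x $ j *s column j (B :: complex^'s^'n))"
  by (simp add: vec_eq_iff matrix_vector_mult_def column_def mult.commute)

lemma det_nonzero_if_injective:
  fixes M :: "complex^'s^'s"
  assumes "\<And>c. M *v c = 0 \<Longrightarrow> c = 0"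
  shows "det M \<noteq> 0"
  using assms matrix_left_invertible_ker[of M] invertible_left_inverse[of M] invertible_det_nz[of M] by blast

subsection \<open>Angles\<close>

text \<open>The distance from \<open>x\<close> to the line through \<open>y\<close> is attained at
  the orthogonal projection, and by Pythagoras it equals the sine times \<open>norm x\<close>.
  Cauchy-Schwarz keeps the argument of \<open>arccos\<close> in the unit interval.\<close>

lemma sin_vector_angle_projection:
  fixes x y :: "complex^'n"
  assumes "x \<noteq> 0" "y \<noteq> 0"
  shows "\<exists>a. norm (x - a *s y) = sin (vector_angle x y) * norm x"
    and "sin (vector_angle x y) * norm x \<le> norm (x - b *s y)"
    and "0 \<le> vector_angle x y" "vector_angle x y \<le> pi / 2"
proof -
  define c where "c = cmod (cinner x y) / (norm x * norm y)"
  have c: "0 \<le> c" "c \<le> 1"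
    using assms cmod_cinner_le[of x y] by (auto simp: c_def divide_le_eq)
  have va: "vector_angle x y = arccos c" by (simp add: vector_angle_def c_def)
  show "0 \<le> vector_angle x y" unfolding va using c by (intro arccos_lbound) auto
  show "vector_angle x y \<le> pi / 2" unfolding va using c by (intro arccos_le_pi2) auto
  define a where "a = cinner y x / cinner y y"
  have orth: "cinner (x - a *s y) y = 0"
    using assms by (subst cinner_zero_commute)
      (simp add: cinner_diff_right cinner_scale_right a_def cinner_self)
  have orth': "cinner (x - a *s y) (d *s y) = 0" for d
    using orth by (simp add: cinner_scale_right)
  have ca: "cmod a * norm y = c * norm x"
    using assms by (simp add: a_def c_def norm_divide norm_mult cinner_self power2_eq_square
        cnj_cinner[of x y, symmetric])
  have "(norm x)\<^sup>2 = (norm (x - a *s y))\<^sup>2 + (norm (a *s y))\<^sup>2"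
    using pythagoras[OF orth'[of a]] by simp
  then have "(norm (x - a *s y))\<^sup>2 = (1 - c\<^sup>2) * (norm x)\<^sup>2"
    by (simp add: norm_scale ca power_mult_distrib algebra_simps)
  then have "norm (x - a *s y) = sqrt ((1 - c\<^sup>2) * (norm x)\<^sup>2)"
    using real_sqrt_abs[of "norm (x - a *s y)"] by simp
  then have sq: "norm (x - a *s y) = sin (vector_angle x y) * norm x"
    unfolding va using c by (simp add: sin_arccos real_sqrt_mult)
  then show "\<exists>a. norm (x - a *s y) = sin (vector_angle x y) * norm x" by blast
  have "(norm (x - b *s y))\<^sup>2 = (norm (x - a *s y))\<^sup>2 + (norm ((a - b) *s y))\<^sup>2"
    using pythagoras[OF orth'[of "a - b"]] by (simp add: vec.scale_left_diff_distrib)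
  then have "(norm (x - a *s y))\<^sup>2 \<le> (norm (x - b *s y))\<^sup>2"
    using zero_le_power2[of "norm ((a - b) *s y)"] by linarith
  then have "norm (x - a *s y) \<le> norm (x - b *s y)"
    by (rule power2_le_imp_le) simp
  then show "sin (vector_angle x y) * norm x \<le> norm (x - b *s y)" using sq by simp
qed

lemma bdd_below_vector_angles:
  "bdd_below {vector_angle x y | x y. x \<in> X \<and> x \<noteq> 0 \<and> y \<in> Y \<and> y \<noteq> 0}"
  using sin_vector_angle_projection(3) by (auto intro!: bdd_belowI[of _ 0])

text \<open>The infimum lies below the angle of \<open>x\<close> and \<open>y\<close>, and the sine
  is increasing on the range of these angles. The case \<open>y = 0\<close> is included because an
  approximant from \<open>Y\<close> may vanish; there the bound is
  \<open>sin \<le> 1\<close>.\<close>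

lemma sin_subspace_angle_le:
  assumes "x \<in> X" "x \<noteq> 0" "y \<in> Y"
  shows "sin (subspace_angle X Y) * norm x \<le> norm (x - y)"
proof (cases "y = 0")
  case True
  then show ?thesis using mult_right_mono[OF sin_le_one norm_ge_zero, of "subspace_angle X Y" x] by simp
next
  case False
  let ?S = "{vector_angle x y | x y. x \<in> X \<and> x \<noteq> 0 \<and> y \<in> Y \<and> y \<noteq> 0}"
  have mem: "vector_angle x y \<in> ?S" using assms False by blast
  have "subspace_angle X Y \<le> vector_angle x y"
    unfolding subspace_angle_def by (rule cInf_lower[OF mem bdd_below_vector_angles])
  moreover have "0 \<le> subspace_angle X Y"
    unfolding subspace_angle_def using mem sin_vector_angle_projection(3)
    by (intro cInf_greatest) auto
  ultimately have "sin (subspace_angle X Y) \<le> sin (vector_angle x y)"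
    using sin_vector_angle_projection(4)[OF assms(2) False]
    by (intro sin_monotone_2pi_le) auto
  then have "sin (subspace_angle X Y) * norm x \<le> sin (vector_angle x y) * norm x"
    by (intro mult_right_mono) auto
  also have "\<dots> \<le> norm (x - y)"
    using sin_vector_angle_projection(2)[OF assms(2) False, of 1] by simp
  finally show ?thesis .
qed

text \<open>Attainment of the infimum is avoided: the angles satisfying the inequality form a closed
  set, which contains the infimum of any nonempty subset bounded below.\<close>

lemma sin_subspace_angle_ge:
  assumes ne: "x0 \<in> X" "x0 \<noteq> 0" "y0 \<in> Y" "y0 \<noteq> 0"
    and le: "\<And>x y. x \<in> X \<Longrightarrow> x \<noteq> 0 \<Longrightarrow> y \<in> Y \<Longrightarrow> y \<noteq> 0 \<Longrightarrow> s \<le> c * sin (vector_angle x y)"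
  shows "s \<le> c * sin (subspace_angle X Y)"
proof -
  let ?S = "{vector_angle x y | x y. x \<in> X \<and> x \<noteq> 0 \<and> y \<in> Y \<and> y \<noteq> 0}"
  have "closed {\<alpha>. s \<le> c * sin \<alpha>}" by (intro closed_Collect_le continuous_intros)
  moreover have "?S \<subseteq> {\<alpha>. s \<le> c * sin \<alpha>}" using le by auto
  moreover have "?S \<noteq> {}" using ne by blast
  ultimately have "Inf ?S \<in> {\<alpha>. s \<le> c * sin \<alpha>}"
    by (intro closed_subset_contains_Inf bdd_below_vector_angles)
  then show ?thesis by (simp add: subspace_angle_def)
qed

subsection \<open>Spectral bounds\<close>

text \<open>The component of \<open>P C (P x) - \<tau> P x = - P C (x - P x)\<close> in \<open>Z\<close> involves \<open>z\<close> only, because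
  \<open>U\<close> and \<open>Z\<close> are orthogonal and both invariant.\<close>

lemma ritz_complement_bound:
  fixes C P :: "complex^'n^'n"
  assumes P: "P ** P = P" and E: "orthogonal_basis E Z" and Z: "vec.subspace Z" and U: "vec.subspace U"
    and ev: "\<And>e. e \<in> E \<Longrightarrow> (P ** C ** P) *v e = ev e *s e"
    and ZB: "\<And>z. z \<in> Z \<Longrightarrow> (P ** C ** P) *v z \<in> Z"
    and UB: "\<And>u. u \<in> U \<Longrightarrow> (P ** C ** P) *v u \<in> U"
    and orth: "\<And>z u. z \<in> Z \<Longrightarrow> u \<in> U \<Longrightarrow> cinner z u = 0"
    and PZ: "\<And>z. z \<in> Z \<Longrightarrow> P *v z = z"
    and x: "C *v x = \<tau> *s x" and split: "P *v x = u + z" "u \<in> U" "z \<in> Z"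
    and d: "0 \<le> d" "\<And>e. e \<in> E \<Longrightarrow> d \<le> cmod (ev e - \<tau>)"
  shows "d * norm z \<le> frobenius_norm (P ** C ** (mat 1 - P)) * norm (x - P *v x)"
proof -
  let ?B = "P ** C ** P" and ?N = "P ** C ** (mat 1 - P)"
  define w where "w = ?B *v z - \<tau> *s z"
  have w: "w \<in> Z" unfolding w_def using split Z ZB by (simp add: vec.subspace_diff vec.subspace_scale)
  have Px: "P *v (P *v x) = P *v x" by (simp add: matrix_vector_mul_assoc P)
  \<comment> \<open>Pairing with \<open>w\<close> removes the \<open>U\<close> component. What
    remains of the projected equation is computed from \<open>C *v x = \<tau> *s x\<close>, which
    gives \<open>P *v (C *v x) = \<tau> *s (P *v x)\<close>.\<close>
  have "cinner w (?B *v u - \<tau> *s u) = 0"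
    using split U UB by (intro orth w) (simp add: vec.subspace_diff vec.subspace_scale)
  moreover have "w + (?B *v u - \<tau> *s u) = ?B *v (P *v x) - \<tau> *s (P *v x)"
    unfolding split(1) w_def by (simp add: matrix_vector_right_distrib vec.scale_right_distrib)
  moreover have "?B *v (P *v x) - \<tau> *s (P *v x) = - (?N *v (x - P *v x))"
    by (simp add: matrix_vector_mul_assoc[symmetric] matrix_vector_mult_diff_rdistrib
        matrix_vector_mult_diff_distrib Px x vec.scale)
  ultimately have "cinner w w = - cinner w (?N *v (x - P *v x))"
    by (metis add.right_neutral cinner_add_right cinner_diff_right cinner_zero(1) diff_0)
  then have "(norm w)\<^sup>2 = cmod (cinner w (?N *v (x - P *v x)))"
    by (metis cinner_self norm_minus_cancel norm_of_real abs_power2 power2_abs)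
  also have "\<dots> \<le> norm w * norm (?N *v (x - P *v x))" by (rule cmod_cinner_le)
  also have "\<dots> \<le> norm w * (frobenius_norm ?N * norm (x - P *v x))"
    by (intro mult_left_mono norm_matrix_vector_le) auto
  finally have "norm w \<le> frobenius_norm ?N * norm (x - P *v x)"
    by (cases "norm w = 0") (auto simp: power2_eq_square frobenius_norm_def sum_nonneg)
  moreover have "d * norm z \<le> norm w"
    unfolding w_def using eigenbasis_norm_bounds(1)[of E Z ?B ev z d \<tau>] E ev split(3) d by blast
  ultimately show ?thesis by simp
qed

section \<open>Adjoints, the shifted matrix and its extreme singular values\<close>

lemma ctranspose_mul: "ctranspose (S ** T) = ctranspose T ** ctranspose S"
  by (simp add: ctranspose_def matrix_matrix_mult_def vec_eq_iff mult.commute)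

lemma ctranspose_ctranspose [simp]: "ctranspose (ctranspose T) = T"
  by (simp add: ctranspose_def vec_eq_iff)

lemma ctranspose_mat_real: "ctranspose (mat (complex_of_real r)) = mat (complex_of_real r)"
  by (simp add: ctranspose_def mat_def vec_eq_iff)

lemma ctranspose_diff: "ctranspose (S - T) = ctranspose S - ctranspose T"
  by (simp add: ctranspose_def vec_eq_iff)

lemma hermitian_shifted: "hermitian A \<Longrightarrow> hermitian (shifted A \<sigma>)"
  by (simp add: hermitian_def shifted_def ctranspose_diff ctranspose_mat_real)

lemma mat_mult_vec: "mat c *v x = c *s x"
  by (simp add: vec_eq_iff matrix_vector_mult_def mat_def if_distrib[of "\<lambda>u. u * _"] cong: if_cong)

lemma shifted_mult_vec: "shifted A \<sigma> *v x = A *v x - complex_of_real \<sigma> *s x"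
  by (simp add: shifted_def matrix_vector_mult_diff_rdistrib mat_mult_vec)

lemma hermitian_eigenbasis_UNIV:
  fixes A :: "complex^'n^'n"
  assumes "hermitian A"
  obtains E ev where "orthogonal_basis E UNIV" "\<And>e. e \<in> E \<Longrightarrow> A *v e = ev e *s e"
proof -
  obtain E where E: "orthogonal_basis E (UNIV :: (complex^'n) set)" "\<forall>e\<in>E. \<exists>\<mu>. A *v e = \<mu> *s e"
    using hermitian_orthogonal_eigenbasis[OF assms, of UNIV] by auto
  then obtain ev where "\<forall>e\<in>E. A *v e = ev e *s e" by metis
  with E(1) show ?thesis using that by blast
qed

text \<open>A value different from all eigenvalues on the eigenbasis keeps a positive distance from
  them, so \<open>A - \<mu>\<close> is bounded below and \<open>\<mu>\<close> is no eigenvalue.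
  Finiteness gives meaning to \<open>Max\<close> and \<open>Min\<close> in
  \<open>shifted_cond\<close>.\<close>

lemma finite_spectrum_hermitian:
  fixes A :: "complex^'n^'n"
  assumes "hermitian A"
  shows "finite (spectrum A)"
proof -
  obtain E ev where E: "orthogonal_basis E UNIV" and ev: "\<And>e. e \<in> E \<Longrightarrow> A *v e = ev e *s e"
    using hermitian_eigenbasis_UNIV[OF assms] by blast
  have fin: "finite E" using E by (simp add: orthogonal_basis_def)
  have "\<mu> \<in> ev ` E" if mu: "\<mu> \<in> spectrum A" for \<mu>
  proof (rule ccontr)
    assume *: "\<mu> \<notin> ev ` E"
    \<comment> \<open>The inserted 1 keeps the set nonempty without a case distinction on
      \<open>E\<close>.\<close>
    define lo where "lo = Min (insert 1 ((\<lambda>e. cmod (ev e - \<mu>)) ` E))"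
    have lo: "lo > 0" unfolding lo_def using fin * by (subst Min_gr_iff) auto
    have le: "lo \<le> cmod (ev e - \<mu>)" if "e \<in> E" for e
      unfolding lo_def using that fin by (intro Min_le) auto
    obtain x where x: "x \<noteq> 0" "A *v x = \<mu> *s x" using mu by (auto simp: spectrum_def)
    have "lo * norm x \<le> norm (A *v x - \<mu> *s x)"
      using eigenbasis_norm_bounds(1)[of E UNIV A ev x lo \<mu>] E ev le lo by auto
    then show False using x lo by (simp add: mult_le_0_iff)
  qed
  then show ?thesis by (intro finite_subset[OF subsetI finite_imageI[OF fin]])
qed

text \<open>Identifies the numerator and denominator of \<open>shifted_cond\<close> as upper and
  lower bounds on the stretching by the shifted matrix.\<close>

lemma shifted_norm_bounds:
  fixes A :: "complex^'n^'n" and \<sigma> :: real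
  assumes A: "hermitian A"
  defines "D \<equiv> (\<lambda>\<mu>. cmod (\<mu> - complex_of_real \<sigma>)) ` spectrum A"
  shows "Min D * norm x \<le> norm (shifted A \<sigma> *v x)"
    and "norm (shifted A \<sigma> *v x) \<le> Max D * norm x"
proof -
  obtain E ev where E: "orthogonal_basis E UNIV" and ev: "\<And>e. e \<in> E \<Longrightarrow> A *v e = ev e *s e"
    using hermitian_eigenbasis_UNIV[OF A] by blast
  have D: "finite D" using finite_spectrum_hermitian[OF A] by (simp add: D_def)
  have mem: "cmod (ev e - complex_of_real \<sigma>) \<in> D" if "e \<in> E" for e
  proof -
    have "e \<noteq> 0" using that E by (auto simp: orthogonal_basis_def)
    then have "ev e \<in> spectrum A" using ev[OF that] by (auto simp: spectrum_def)
    then show ?thesis by (simp add: D_def)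
  qed
  have "E \<noteq> {}"
  proof
    assume "E = {}"
    then have "(axis undefined 1 :: complex^'n) \<in> {0}"
      using E by (simp add: orthogonal_basis_def)
    then show False by (simp add: axis_eq_0_iff)
  qed
  then have ne: "D \<noteq> {}" using mem by blast
  have nonneg: "0 \<le> d" if "d \<in> D" for d using that by (auto simp: D_def)
  show "Min D * norm x \<le> norm (shifted A \<sigma> *v x)"
    unfolding shifted_mult_vec
    using eigenbasis_norm_bounds(1)[of E UNIV A ev x "Min D" "complex_of_real \<sigma>"] E ev
      Min_le[OF D mem] nonneg[OF Min_in[OF D ne]] by auto
  show "norm (shifted A \<sigma> *v x) \<le> Max D * norm x"
    unfolding shifted_mult_vec
    using eigenbasis_norm_bounds(2)[of E UNIV A ev x "Max D" "complex_of_real \<sigma>"] E ev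
      Max_ge[OF D mem] nonneg[OF Max_in[OF D ne]] by auto
qed

section \<open>Column spans, orthogonal splitting and the gap in reciprocal form\<close>

lemma range_eq_span_columns: "range ((*v) K) = vec.span (columns (K :: complex^'s^'n))"
proof
  have col: "column j K \<in> vec.span (columns K)" for j
    by (rule vec.span_base) (unfold columns_def, blast)
  have "K *v x \<in> vec.span (columns K)" for x
    unfolding matrix_vector_eq_sum_columns[of K x]
    by (rule vec.span_sum, rule vec.span_scale, rule col)
  then show "range ((*v) K) \<subseteq> vec.span (columns K)" by blast
  have "column j K = K *v axis j 1" for j
    by (simp add: vec_eq_iff column_def matrix_vector_mult_def axis_def if_distrib[of "\<lambda>u. _ * u"] cong: if_cong)
  then have "columns K \<subseteq> range ((*v) K)" by (auto simp: columns_def)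
  moreover have "vec.subspace (range ((*v) K))"
    by (rule vec.subspace_image) (rule vec.subspace_UNIV)
  ultimately show "vec.span (columns K) \<subseteq> range ((*v) K)" by (rule vec.span_minimal)
qed

text \<open>Independence of the set \<open>columns K\<close> alone cannot see repeated columns;
  injectivity of the column indexing lets the entries of \<open>c\<close> serve as coefficients of
  distinct vectors.\<close>

lemma basis_matrix_injective:
  fixes K :: "complex^'s^'n"
  assumes K: "basis_matrix K \<K>" and c: "K *v c = 0"
  shows "c = 0"
proof -
  have inj: "inj (\<lambda>j. column j K)" and ind: "vec.independent (columns K)"
    using K by (auto simp: basis_matrix_def)
  have cols: "columns K = range (\<lambda>j. column j K)" by (auto simp: columns_def)
  define a where "a w = c $ inv (\<lambda>j. column j K) w" for w
  have a: "a (column j K) = c $ j" for j using inj by (simp add: a_def inv_f_f[OF inj])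
  have "(\<Sum>w\<in>columns K. a w *s w) = 0"
    unfolding cols using c by (simp add: sum.reindex[OF inj] a matrix_vector_eq_sum_columns)
  then have "a w = 0" if "w \<in> columns K" for w
    using ind that by (auto simp: vec.independent_explicit)
  then have "c $ j = 0" for j using a[of j] by (auto simp: cols)
  then show ?thesis by (simp add: vec_eq_iff)
qed

text \<open>The real orthogonal decomposition suffices: real orthogonality to both \<open>w\<close>
  and its multiple by the imaginary unit makes the real and imaginary parts of
  \<open>cinner w z\<close> vanish.\<close>

lemma orthogonal_decomposition:
  fixes U :: "(complex^'n) set"
  assumes U: "vec.subspace U"
  obtains u z where "x = u + z" "u \<in> U" "\<And>u'. u' \<in> U \<Longrightarrow> cinner u' z = 0"
proof -
  have "subspace U"
    using U by (simp add: subspace_def vec.subspace_def scaleR_vec_scale)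
  then have sp: "span U = U" by simp
  obtain u z where uz: "u \<in> U" "\<And>w. w \<in> U \<Longrightarrow> orthogonal z w" "x = u + z"
    using orthogonal_subspace_decomp_exists[of U x] unfolding sp by metis
  have "cinner w z = 0" if "w \<in> U" for w
  proof -
    have "Re (cinner w' z) = 0" if "w' \<in> U" for w'
      using uz(2)[OF that] by (simp add: Re_cinner orthogonal_def inner_commute)
    from this[of w] this[of "\<i> *s w"] that U show ?thesis
      by (simp add: vec.subspace_scale cinner_scale_left complex_eq_iff)
  qed
  with uz show ?thesis using that by blast
qed

text \<open>The quotient in the gap is a difference of reciprocals,
  \<open>1 / (lam - \<sigma>) - 1 / (\<theta> - \<sigma>)\<close>, so the gap measures distances
  between eigenvalues of the inverse. The infinite Ritz value fits in as
  \<open>\<mu> = 0\<close>.\<close>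

lemma gap_term_ritz_of:
  assumes "lam \<noteq> complex_of_real \<sigma>"
  shows "gap_term lam \<sigma> (ritz_of \<sigma> \<mu>) = cmod (\<mu> - 1 / (lam - complex_of_real \<sigma>))"
proof (cases "\<mu> = 0")
  case True
  then show ?thesis by (simp add: ritz_of_def norm_divide)
next
  case False
  have h: "lam - complex_of_real \<sigma> \<noteq> 0" using assms by simp
  have "(1 / \<mu> + complex_of_real \<sigma> - lam) / ((lam - complex_of_real \<sigma>) * (1 / \<mu>)) =
      1 / (lam - complex_of_real \<sigma>) - \<mu>"
    using False h by (simp add: field_simps)
  then show ?thesis using False by (simp add: ritz_of_def norm_minus_commute)
qed

subsection \<open>Harmonic Ritz pairs as Ritz pairs of the inverse\<close>

locale harmonic_ritz =
  fixes A P :: "complex^'n^'n" and K :: "complex^'s^'n" and \<sigma> :: real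
  assumes hermitian_A: "hermitian A"
    and shift_regular: "complex_of_real \<sigma> \<notin> spectrum A"
    and K_injective: "K *v c = 0 \<Longrightarrow> c = 0"
    and projector: "orthogonal_projector P (range ((*v) (shifted A \<sigma> ** K)))"
begin

abbreviation "M \<equiv> shifted A \<sigma>"
abbreviation "C \<equiv> matrix_inv M"
abbreviation "W \<equiv> M ** K"
abbreviation "B \<equiv> P ** C ** P"

lemma hermitian_M: "hermitian M"
  by (rule hermitian_shifted[OF hermitian_A])

lemma M_injective: "M *v x = 0 \<Longrightarrow> x = 0"
  using shift_regular by (auto simp: shifted_mult_vec spectrum_def)

lemma inverse_M: "C ** M = mat 1" "M ** C = mat 1"
proof -
  have "invertible M"
    using M_injective matrix_left_invertible_ker[of M] invertible_left_inverse[of M] by blast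
  then have "M ** C = mat 1 \<and> C ** M = mat 1"
    unfolding matrix_inv_def invertible_def by (rule someI_ex)
  then show "C ** M = mat 1" "M ** C = mat 1" by simp_all
qed

lemma inverse_M_vec [simp]: "C *v (M *v x) = x"
  by (simp add: matrix_vector_mul_assoc inverse_M)

lemma hermitian_C: "hermitian C"
proof -
  have "ctranspose C ** M = mat 1"
    using ctranspose_mul[of M C] hermitian_M ctranspose_mat_real[of 1, where 'a = 'n]
    by (simp add: inverse_M hermitian_def)
  then have "ctranspose C ** M ** C = C" by simp
  then show ?thesis by (simp add: matrix_mul_assoc[symmetric] inverse_M hermitian_def)
qed

lemma hermitian_P: "hermitian P" and P_idem: "P ** P = P" and range_P: "range ((*v) P) = range ((*v) W)"
  using projector by (auto simp: orthogonal_projector_def hermitian_def)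

lemma P_fixes: "q \<in> range ((*v) W) \<Longrightarrow> P *v q = q"
  unfolding range_P[symmetric] by (auto simp: matrix_vector_mul_assoc P_idem)

lemma P_in_range: "P *v x \<in> range ((*v) W)"
  unfolding range_P[symmetric] by simp

lemma hermitian_B: "hermitian B"
  using hermitian_P hermitian_C by (simp add: hermitian_def ctranspose_mul matrix_mul_assoc)

lemma W_injective: "W *v c = 0 \<Longrightarrow> c = 0"
  using K_injective M_injective by (simp add: matrix_vector_mul_assoc[symmetric])

lemma P_residual_orthogonal: "q \<in> range ((*v) W) \<Longrightarrow> cinner (x - P *v x) q = 0"
  using P_fixes cinner_hermitian[OF hermitian_P, of x q] by (auto simp: cinner_diff_left)

text \<open>As \<open>M\<close> is Hermitian, one factor \<open>M\<close> goes to each side: the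
  left matrix is the Gram matrix of \<open>W\<close>, and below, the right one is the compression of
  \<open>C\<close> by \<open>W\<close>.\<close>

lemma pencil_lhs_eq: "pencil_lhs A \<sigma> K = ctranspose W ** W"
  using hermitian_M by (simp add: pencil_lhs_def ctranspose_mul hermitian_def matrix_mul_assoc)

lemma pencil_rhs_eq: "pencil_rhs A \<sigma> K = ctranspose W ** C ** W"
proof -
  have "ctranspose W ** C ** W = ctranspose K ** M ** (C ** M) ** K"
    using hermitian_M by (simp add: ctranspose_mul hermitian_def matrix_mul_assoc)
  then show ?thesis by (simp add: pencil_rhs_def inverse_M)
qed

lemma pencil_lhs_injective:
  assumes "pencil_lhs A \<sigma> K *v c = 0"
  shows "c = 0"
proof -
  have "cinner (W *v c) (W *v c) = cinner c (pencil_lhs A \<sigma> K *v c)"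
    unfolding pencil_lhs_eq matrix_vector_mul_assoc[of "ctranspose W", symmetric] cinner_adjoint[of c] by simp
  then show ?thesis using assms W_injective by (simp add: cinner_self)
qed

text \<open>Both kernels are the orthogonal complement of the range of \<open>W\<close>. This turns
  the Galerkin condition of the pencil into an equation projected by \<open>P\<close>.\<close>

lemma ctranspose_W_kernel: "ctranspose W *v y = 0 \<longleftrightarrow> P *v y = 0"
proof
  assume y: "ctranspose W *v y = 0"
  obtain c where c: "P *v y = W *v c" using P_in_range by blast
  have "cinner (P *v y) (P *v y) = cinner (P *v (P *v y)) y"
    by (rule cinner_hermitian[OF hermitian_P])
  also have "P *v (P *v y) = W *v c"
    using P_fixes[OF P_in_range] c by metis
  also have "cinner (W *v c) y = cinner c (ctranspose W *v y)" by (simp add: cinner_adjoint)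
  finally show "P *v y = 0" using y by (simp add: cinner_self)
next
  assume y: "P *v y = 0"
  have "cinner c (ctranspose W *v y) = 0" for c
  proof -
    have "P *v (W *v c) = W *v c" by (rule P_fixes) simp
    then have "cinner c (ctranspose W *v y) = cinner (P *v (W *v c)) y"
      by (simp only: cinner_adjoint ctranspose_ctranspose)
    also have "\<dots> = cinner (W *v c) (P *v y)" by (rule cinner_hermitian[OF hermitian_P, symmetric])
    finally show ?thesis using y by simp
  qed
  from this[of "ctranspose W *v y"] show "ctranspose W *v y = 0" by (simp add: cinner_self)
qed

text \<open>Under \<open>q = W c\<close> the pencil becomes the Rayleigh-Ritz problem of the inverse of \<open>M\<close> on \<open>Q\<close>,
  with Ritz value \<open>\<mu> = 1 / \<xi>\<close>; in particular \<open>\<xi> = \<infinity>\<close> corresponds to \<open>\<mu> = 0\<close>.\<close>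

lemma pencil_eigen_iff:
  "pencil_rhs A \<sigma> K *v c = \<mu> *s (pencil_lhs A \<sigma> K *v c) \<longleftrightarrow> B *v (W *v c) = \<mu> *s (W *v c)"
proof -
  let ?y = "C *v (W *v c) - \<mu> *s (W *v c)"
  have PW: "P *v (W *v c) = W *v c" by (rule P_fixes) simp
  have "pencil_rhs A \<sigma> K *v c - \<mu> *s (pencil_lhs A \<sigma> K *v c) = ctranspose W *v ?y"
    unfolding pencil_lhs_eq pencil_rhs_eq
    by (simp only: matrix_vector_mul_assoc[symmetric] matrix_vector_mult_diff_distrib vec.scale)
  moreover have "B *v (W *v c) - \<mu> *s (W *v c) = P *v ?y"
    by (simp only: matrix_vector_mul_assoc[of _ P, symmetric] matrix_vector_mul_assoc[of P C, symmetric]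
        matrix_vector_mult_diff_distrib vec.scale PW)
  ultimately show ?thesis using ctranspose_W_kernel[of ?y] by (metis right_minus_eq)
qed

lemma harmonic_ritz_pairD:
  assumes "harmonic_ritz_pair A \<sigma> K t v"
  obtains \<mu> where "M *v v \<in> range ((*v) W)" "B *v (M *v v) = \<mu> *s (M *v v)" "t = ritz_of \<sigma> \<mu>"
proof (cases t)
  case Inf_Ritz
  then obtain c where c: "pencil_rhs A \<sigma> K *v c = 0" "v = K *v c" using assms by auto
  then have "B *v (W *v c) = 0 *s (W *v c)" using pencil_eigen_iff[of c 0] by simp
  with c Inf_Ritz show ?thesis
    by (intro that[of 0]) (auto simp: matrix_vector_mul_assoc ritz_of_def)
next
  case (Fin_Ritz \<theta>)
  then obtain \<xi> c where c: "c \<noteq> 0"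
      "pencil_lhs A \<sigma> K *v c = \<xi> *s (pencil_rhs A \<sigma> K *v c)" "v = K *v c"
    and th: "\<theta> = \<xi> + complex_of_real \<sigma>" using assms by auto
  \<comment> \<open>The Gram matrix on the left is injective and \<open>c \<noteq> 0\<close>, so
    \<open>\<xi> = 0\<close> cannot occur and the reciprocal is available.\<close>
  have xi: "\<xi> \<noteq> 0" using c pencil_lhs_injective by auto
  then have "pencil_rhs A \<sigma> K *v c = (1 / \<xi>) *s (pencil_lhs A \<sigma> K *v c)" using c(2) by simp
  then have "B *v (W *v c) = (1 / \<xi>) *s (W *v c)" by (simp only: pencil_eigen_iff)
  with c(3) th xi Fin_Ritz show ?thesis
    by (intro that[of "1 / \<xi>"]) (auto simp: matrix_vector_mul_assoc ritz_of_def)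
qed

lemma dim_range_W: "vec.dim (range ((*v) W)) = CARD('s)"
proof -
  have "inj ((*v) W)" using W_injective by (simp add: vec.inj_iff_eq_0)
  then have "vec.dim (range ((*v) W)) = vec.dim (UNIV :: (complex^'s) set)"
    by (intro vec.dim_image_eq) (auto intro: inj_on_subset)
  then show ?thesis by (simp add: vec.dim_UNIV card_cart_basis)
qed

text \<open>The eigenbasis \<open>F\<close> of \<open>B\<close> on the range of \<open>W\<close> is
  pulled back through \<open>W\<close>; the coefficient vectors form the columns of an invertible
  \<open>S\<close> that diagonalises the pencil.\<close>

lemma harmonic_ritz_values_eigenbasis:
  assumes F: "finite F" "vec.independent F" "vec.span F = range ((*v) W)"
    and ev: "\<And>f. f \<in> F \<Longrightarrow> B *v f = ev f *s f"
  shows "harmonic_ritz_values A \<sigma> K = image_mset (\<lambda>f. ritz_of \<sigma> (ev f)) (mset_set F)"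
proof -
  \<comment> \<open>The cardinality matches the index type, so the basis can be listed as the
    columns of a square matrix.\<close>
  have "card F = CARD('s)"
    using vec.dim_span_eq_card_independent[OF F(2)] dim_range_W F(3) by simp
  then obtain b where b: "bij_betw b (UNIV :: 's set) F"
    using finite_same_card_bij[OF finite_class.finite_UNIV F(1)] by metis
  have "\<exists>c. b j = W *v c" for j
  proof -
    have "b j \<in> F" using b by (simp add: bij_betw_apply)
    then have "b j \<in> range ((*v) W)" unfolding F(3)[symmetric] by (rule vec.span_base)
    then show ?thesis by blast
  qed
  then obtain c where c: "\<And>j. b j = W *v c j" by metis
  define S :: "complex^'s^'s" where "S = (\<chi> i j. c j $ i)"
  have col: "column j S = c j" for j by (simp add: S_def column_def vec_eq_iff)
  have "x = 0" if "S *v x = 0" for x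
  proof -
    define a where "a f = x $ inv_into UNIV b f" for f
    have inj: "inj b" and img: "range b = F" using b by (auto simp: bij_betw_def)
    have a: "a (b j) = x $ j" for j by (simp add: a_def inv_f_f[OF inj])
    have "(\<Sum>f\<in>F. a f *s f) = (\<Sum>j\<in>UNIV. x $ j *s (W *v c j))"
      unfolding img[symmetric] by (simp add: sum.reindex[OF inj] a c[symmetric])
    also have "\<dots> = W *v (S *v x)"
      by (simp add: matrix_vector_eq_sum_columns[of S] col vec.sum vec.scale)
    also have "\<dots> = 0" using that by simp
    finally have "a f = 0" if "f \<in> F" for f
      using F(2) that by (auto simp: vec.independent_explicit)
    then have "x $ j = 0" for j using a[of j] img by auto
    then show ?thesis by (simp add: vec_eq_iff)
  qed
  then have "harmonic_ritz_values A \<sigma> K = image_mset (\<lambda>j. ritz_of \<sigma> (ev (b j))) (mset_set UNIV)"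
  proof (intro harmonic_ritz_values_pencil_eigenbasis det_nonzero_if_injective)
    show "c = 0" if "pencil_lhs A \<sigma> K *v c = 0" for c using that by (rule pencil_lhs_injective)
    show "pencil_rhs A \<sigma> K *v column j S = ev (b j) *s (pencil_lhs A \<sigma> K *v column j S)" for j
      unfolding pencil_eigen_iff col c[symmetric] using b by (intro ev) (auto simp: bij_betw_def)
  qed auto
  also have "\<dots> = image_mset (\<lambda>f. ritz_of \<sigma> (ev f)) (image_mset b (mset_set UNIV))"
    by (simp add: multiset.map_comp o_def)
  also have "image_mset b (mset_set UNIV) = mset_set F"
    using b by (simp add: bij_betw_def image_mset_mset_set)
  finally show ?thesis .
qed


text \<open>Completing the given Ritz vectors by an eigenbasis of the orthogonal complement gives an
  eigenbasis of all of \<open>Q\<close>; the multiset of all harmonic Ritz values is read off from it, so the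
  difference of multisets is exactly the part belonging to the complement.\<close>

lemma ritz_remainder:
  assumes w: "finite I" "inj_on w I" "vec.independent (w ` I)"
    and w_range: "\<And>i. i \<in> I \<Longrightarrow> w i \<in> range ((*v) W)"
    and w_eigen: "\<And>i. i \<in> I \<Longrightarrow> B *v w i = \<mu> i *s w i"
  obtains Z E ev where
    "vec.subspace Z" "Z \<subseteq> range ((*v) W)" "orthogonal_basis E Z"
    "\<And>e. e \<in> E \<Longrightarrow> B *v e = ev e *s e"
    "\<And>z. z \<in> Z \<Longrightarrow> B *v z \<in> Z"
    "\<And>u. u \<in> vec.span (w ` I) \<Longrightarrow> B *v u \<in> vec.span (w ` I)"
    "\<And>z u. z \<in> Z \<Longrightarrow> u \<in> vec.span (w ` I) \<Longrightarrow> cinner z u = 0"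
    "\<And>q. q \<in> range ((*v) W) \<Longrightarrow> \<exists>u\<in>vec.span (w ` I). \<exists>z\<in>Z. q = u + z"
    "harmonic_ritz_values A \<sigma> K - image_mset (\<lambda>i. ritz_of \<sigma> (\<mu> i)) (mset_set I) =
      image_mset (\<lambda>e. ritz_of \<sigma> (ev e)) (mset_set E)"
proof -
  define Q where "Q = range ((*v) W)"
  define U where "U = vec.span (w ` I)"
  define Z where "Z = {z \<in> Q. \<forall>u\<in>U. cinner u z = 0}"
  have Q: "vec.subspace Q" unfolding Q_def by (rule vec.subspace_image) (rule vec.subspace_UNIV)
  have U: "vec.subspace U" unfolding U_def by (rule vec.subspace_span)
  have UQ: "U \<subseteq> Q" unfolding U_def using w_range by (intro vec.span_minimal Q) (auto simp: Q_def)
  have Z: "vec.subspace Z"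
    using Q by (auto simp: Z_def vec.subspace_def cinner_add_right cinner_scale_right)
  have ZQ: "Z \<subseteq> Q" by (auto simp: Z_def)
  have UB: "B *v u \<in> U" if "u \<in> U" for u
    using that unfolding U_def
  proof (induction rule: vec.span_induct_alt)
    case base then show ?case by (simp add: vec.span_zero)
  next
    case (step c y z)
    then obtain i where i: "i \<in> I" "y = w i" by auto
    have "B *v (c *s y + z) = (c * \<mu> i) *s y + B *v z"
      using w_eigen[OF i(1)] by (simp add: matrix_vector_right_distrib vec.scale i(2))
    then show ?case using step by (simp add: vec.span_add vec.span_scale vec.span_base)
  qed
  have BQ: "B *v x \<in> Q" for x
    unfolding Q_def matrix_vector_mul_assoc[of P, symmetric] matrix_mul_assoc[of P C P, symmetric]
    by (rule P_in_range)
  have ZB: "B *v z \<in> Z" if "z \<in> Z" for z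
    using that UB BQ by (auto simp: Z_def cinner_hermitian[OF hermitian_B])
  have split: "\<exists>u\<in>U. \<exists>z\<in>Z. q = u + z" if q: "q \<in> Q" for q
  proof -
    obtain u z where uz: "q = u + z" "u \<in> U" "\<And>u'. u' \<in> U \<Longrightarrow> cinner u' z = 0"
      using orthogonal_decomposition[OF U] by blast
    have "z = q - u" using uz(1) by simp
    then have "z \<in> Q" using q uz(2) UQ Q by (auto intro: vec.subspace_diff)
    with uz show ?thesis by (auto simp: Z_def)
  qed
  obtain E where E: "orthogonal_basis E Z" "card E \<le> vec.dim Z" "\<forall>e\<in>E. \<exists>\<mu>. B *v e = \<mu> *s e"
    using hermitian_orthogonal_eigenbasis[OF hermitian_B Z ZB] by blast
  have EZ: "E \<subseteq> Z" and finE: "finite E"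
    using E(1) vec.span_superset by (auto simp: orthogonal_basis_def)
  have UZ: "U \<inter> Z = {0}"
    using vec.subspace_0[OF U] vec.subspace_0[OF Z] by (auto simp: Z_def cinner_self dest: bspec)
  define F where "F = w ` I \<union> E"
  have F: "finite F" using w finE by (simp add: F_def)
  have spanF: "vec.span F = Q"
  proof
    show "vec.span F \<subseteq> Q"
      using w_range EZ ZQ by (intro vec.span_minimal Q) (auto simp: F_def Q_def)
    show "Q \<subseteq> vec.span F"
    proof
      fix q assume "q \<in> Q"
      then obtain u z where uz: "u \<in> U" "z \<in> Z" "q = u + z" using split by blast
      have "U \<subseteq> vec.span F" unfolding U_def F_def by (rule vec.span_mono) simp
      moreover have "Z \<subseteq> vec.span F"
        using E(1) vec.span_mono[of E F] by (auto simp: orthogonal_basis_def F_def)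
      ultimately show "q \<in> vec.span F" using uz by (auto intro: vec.span_add)
    qed
  qed
  \<comment> \<open>Independence of \<open>F\<close> is obtained by counting: \<open>F\<close> spans
    \<open>Q\<close> and has at most \<open>vec.dim U + vec.dim Z = vec.dim Q\<close>
    members.\<close>
  have "card F \<le> vec.dim Q"
  proof -
    have "{x + y |x y. x \<in> U \<and> y \<in> Z} = Q"
      using split UQ ZQ Q by (auto intro: vec.subspace_add) blast
    then have "vec.dim Q + vec.dim (U \<inter> Z) = vec.dim U + vec.dim Z"
      using vec.dim_sums_Int[OF U Z] by simp
    then have "vec.dim Q = card (w ` I) + vec.dim Z"
      unfolding UZ using vec.dim_span_eq_card_independent[OF w(3)] by (simp add: U_def)
    moreover have "card F \<le> card (w ` I) + card E" unfolding F_def by (rule card_Un_le)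
    ultimately show ?thesis using E(2) by linarith
  qed
  then have indF: "vec.independent F"
    using spanF vec.span_superset[of F] F by (intro vec.card_le_dim_spanning[of F Q]) auto
  have w0: "w i \<noteq> 0" if "i \<in> I" for i
    using w(3) that vec.dependent_zero[of "w ` I"] by (metis imageI)
  \<comment> \<open>Eigenvalues are now attached to vectors, while \<open>\<mu>\<close> is attached
    to indices. The choice must agree with \<open>\<mu>\<close> on the given vectors; injectivity of
    \<open>w\<close> makes it consistent.\<close>
  have "\<exists>m. B *v f = m *s f \<and> (\<forall>i\<in>I. f = w i \<longrightarrow> m = \<mu> i)" if "f \<in> F" for f
  proof (cases "f \<in> w ` I")
    case True
    then obtain i where i: "i \<in> I" "f = w i" by blast
    have "j = i" if "j \<in> I" "f = w j" for j
      using that i w(2) by (simp add: inj_on_def)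
    then show ?thesis using w_eigen[OF i(1)] i(2) by (intro exI[of _ "\<mu> i"]) auto
  next
    case False
    then have "f \<in> E" using that by (simp add: F_def)
    then obtain m where "B *v f = m *s f" using E(3) by blast
    with False show ?thesis by (intro exI[of _ m]) auto
  qed
  then obtain ev where ev: "\<And>f. f \<in> F \<Longrightarrow> B *v f = ev f *s f"
    and ev_w: "\<And>f i. f \<in> F \<Longrightarrow> i \<in> I \<Longrightarrow> f = w i \<Longrightarrow> ev f = \<mu> i"
    by metis
  have disj: "w ` I \<inter> E = {}"
  proof -
    have "w ` I \<subseteq> U" unfolding U_def by (rule vec.span_superset)
    then have "w ` I \<inter> E \<subseteq> {0}" using EZ UZ by blast
    then show ?thesis using w0 by auto
  qed
  have "harmonic_ritz_values A \<sigma> K = image_mset (\<lambda>f. ritz_of \<sigma> (ev f)) (mset_set F)"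
    using harmonic_ritz_values_eigenbasis[of F ev] F indF spanF ev by (simp add: Q_def)
  also have "mset_set F = image_mset w (mset_set I) + mset_set E"
    unfolding F_def using w finE disj by (simp add: mset_set_Union image_mset_mset_set)
  also have "image_mset (\<lambda>f. ritz_of \<sigma> (ev f)) (image_mset w (mset_set I) + mset_set E) =
      image_mset (\<lambda>i. ritz_of \<sigma> (\<mu> i)) (mset_set I) + image_mset (\<lambda>e. ritz_of \<sigma> (ev e)) (mset_set E)"
    using ev_w w(1) by (auto simp: multiset.map_comp F_def intro!: image_mset_cong)
  finally have diff: "harmonic_ritz_values A \<sigma> K - image_mset (\<lambda>i. ritz_of \<sigma> (\<mu> i)) (mset_set I) =
      image_mset (\<lambda>e. ritz_of \<sigma> (ev e)) (mset_set E)" by simp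
  show ?thesis
  proof (rule that[of Z E ev])
    show "B *v e = ev e *s e" if "e \<in> E" for e using ev that by (simp add: F_def)
    show "cinner z u = 0" if "z \<in> Z" "u \<in> vec.span (w ` I)" for z u
      using that by (subst cinner_zero_commute) (simp add: Z_def U_def)
  qed (use Z ZQ E(1) ZB UB split diff in \<open>auto simp: Q_def U_def\<close>)
qed

end

text \<open>Passes from real estimates to the extended real gap. For empty \<open>E\<close> the gap
  is infinite, the quotient is 0 and \<open>n\<close> vanishes; otherwise the infimum is a minimum,
  positive since \<open>\<delta> \<noteq> 0\<close>, and it is inserted for \<open>d\<close> in
  \<open>bound\<close>.\<close>

lemma ritz_gap_bound:
  fixes g :: "'a \<Rightarrow> real" and n \<gamma> y :: real
  assumes fin: "finite E" and g: "\<And>e. e \<in> E \<Longrightarrow> gap_term lam \<sigma> (f e) = g e" "\<And>e. e \<in> E \<Longrightarrow> 0 \<le> g e"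
    and \<delta>: "\<delta> = ritz_gap lam \<sigma> (image_mset f (mset_set E))" "\<delta> \<noteq> 0"
    and bound: "\<And>d. 0 \<le> d \<Longrightarrow> (\<And>e. e \<in> E \<Longrightarrow> d \<le> g e) \<Longrightarrow> d * n \<le> \<gamma> * y"
    and empty: "E = {} \<Longrightarrow> n = 0" and "0 \<le> n"
  shows "n\<^sup>2 \<le> real_of_ereal (ereal (\<gamma>\<^sup>2) / \<delta>\<^sup>2) * y\<^sup>2"
proof (cases "E = {}")
  case True
  then have "\<delta> = \<infinity>" using \<delta>(1) by (simp add: ritz_gap_def top_ereal_def)
  then show ?thesis using empty[OF True] by (simp add: power2_eq_square)
next
  case False
  define d where "d = Min (g ` E)"
  have d: "0 \<le> d" "\<And>e. e \<in> E \<Longrightarrow> d \<le> g e" using fin False g by (auto simp: d_def)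
  have "\<delta> = (INF e\<in>E. ereal (g e))"
    using fin g unfolding \<delta>(1) ritz_gap_def by (simp add: image_image)
  also have "\<dots> = ereal d"
  proof (rule antisym)
    have "d \<in> g ` E" unfolding d_def using fin False by (intro Min_in) auto
    then show "(INF e\<in>E. ereal (g e)) \<le> ereal d" by (auto intro: INF_lower)
    show "ereal d \<le> (INF e\<in>E. ereal (g e))" using d by (intro INF_greatest) simp
  qed
  finally have \<delta>d: "\<delta> = ereal d" .
  then have pos: "d > 0" using \<delta>(2) d(1) by (simp add: zero_ereal_def)
  have "(d * n)\<^sup>2 \<le> (\<gamma> * y)\<^sup>2"
    using bound[OF d] d(1) \<open>0 \<le> n\<close> by (intro power_mono) auto
  then have "n\<^sup>2 \<le> \<gamma>\<^sup>2 / d\<^sup>2 * y\<^sup>2"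
    using pos by (simp add: power_mult_distrib field_simps)
  then show ?thesis using pos by (simp add: \<delta>d power2_eq_square)
qed

subsection \<open>The bound\<close>

theorem theorem4:
  fixes A P :: "complex^'n^'n"
    and K :: "complex^'s^'n"
    and \<K> \<Q> \<V> :: "(complex^'n) set"
    and lam :: complex and \<sigma> \<gamma> :: real and \<delta> :: ereal
    and k :: nat
    and \<theta> :: "nat \<Rightarrow> ritz_value"
    and v :: "nat \<Rightarrow> complex^'n"
  assumes "hermitian A"
    and "lam \<in> spectrum A"
    and "complex_of_real \<sigma> \<notin> spectrum A"
    and "vec.subspace \<K>" and "\<K> \<noteq> {0}"
    and "basis_matrix K \<K>"
    and "k \<ge> 1"
    and "\<And>i. i \<in> {1..k} \<Longrightarrow> harmonic_ritz_pair A \<sigma> K (\<theta> i) (v i)"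
    and "inj_on v {1..k}" and "vec.independent (v ` {1..k})"
    and "\<V> = vec.span (v ` {1..k})"
    and "\<Q> = (\<lambda>x. shifted A \<sigma> *v x) ` \<K>"
    and "orthogonal_projector P \<Q>"
    and "\<gamma> = frobenius_norm (P ** matrix_inv (shifted A \<sigma>) ** (mat 1 - P))"
    and "\<delta> = ritz_gap lam \<sigma> (harmonic_ritz_values A \<sigma> K - image_mset \<theta> (mset_set {1..k}))"
    and "\<delta> \<noteq> 0"
  shows "sin (subspace_angle (eigenspace A lam) \<V>)
    \<le> shifted_cond A \<sigma> * sqrt (1 + real_of_ereal (ereal (\<gamma>\<^sup>2) / \<delta>\<^sup>2))
        * sin (subspace_angle (eigenspace A lam) \<K>)"
proof -
  let ?M = "shifted A \<sigma>" and ?X = "eigenspace A lam"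
  define h where "h = lam - complex_of_real \<sigma>"
  define r where "r = real_of_ereal (ereal (\<gamma>\<^sup>2) / \<delta>\<^sup>2)"
  define D where "D = (\<lambda>\<mu>. cmod (\<mu> - complex_of_real \<sigma>)) ` spectrum A"
  have r: "0 \<le> r"
    unfolding r_def using assms(16) by (cases \<delta>) (auto simp: power2_eq_square zero_ereal_def)
  have lam: "lam \<noteq> complex_of_real \<sigma>" using assms(2,3) by auto
  then have h: "h \<noteq> 0" by (simp add: h_def)
  have \<K>: "\<K> = range ((*v) K)"
    using assms(6) by (simp add: basis_matrix_def range_eq_span_columns)
  have Q: "range ((*v) (?M ** K)) = \<Q>"
    unfolding assms(12) \<K> by (auto simp: matrix_vector_mul_assoc image_iff)
  interpret harmonic_ritz A P K \<sigma>
    using assms(1,3,13) basis_matrix_injective[OF assms(6)] Q by unfold_locales auto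
  have "\<exists>\<mu>. M *v v i \<in> range ((*v) W) \<and> B *v (M *v v i) = \<mu> *s (M *v v i) \<and> \<theta> i = ritz_of \<sigma> \<mu>"
    if "i \<in> {1..k}" for i
    using harmonic_ritz_pairD[OF assms(8)[OF that]] by metis
  then obtain \<mu> where \<mu>: "\<And>i. i \<in> {1..k} \<Longrightarrow> M *v v i \<in> range ((*v) W)"
      "\<And>i. i \<in> {1..k} \<Longrightarrow> B *v (M *v v i) = \<mu> i *s (M *v v i)"
      "\<And>i. i \<in> {1..k} \<Longrightarrow> \<theta> i = ritz_of \<sigma> (\<mu> i)"
    by metis
  let ?w = "\<lambda>i. M *v v i"
  have injM: "inj ((*v) M)" using M_injective by (simp add: vec.inj_iff_eq_0)
  have img: "?w ` {1..k} = (*v) M ` v ` {1..k}" by auto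
  have inj_w: "inj_on ?w {1..k}"
  proof (rule inj_onI)
    fix i j assume "i \<in> {1..k}" "j \<in> {1..k}" "M *v v i = M *v v j"
    then show "i = j" using injD[OF injM] inj_onD[OF assms(9)] by blast
  qed
  have ind_w: "vec.independent (?w ` {1..k})"
    unfolding img by (rule vec.independent_injective_image[OF assms(10)]) (rule inj_on_subset[OF injM], simp)
  have U: "vec.span (?w ` {1..k}) = (*v) M ` \<V>"
    unfolding img assms(11) by (rule vec.span_image)
  obtain Z E ev where Z: "vec.subspace Z" "Z \<subseteq> range ((*v) W)" and E: "orthogonal_basis E Z"
    and ev: "\<And>e. e \<in> E \<Longrightarrow> B *v e = ev e *s e"
    and ZB: "\<And>z. z \<in> Z \<Longrightarrow> B *v z \<in> Z"
    and UB: "\<And>u. u \<in> (*v) M ` \<V> \<Longrightarrow> B *v u \<in> (*v) M ` \<V>"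
    and UZ: "\<And>z u. z \<in> Z \<Longrightarrow> u \<in> (*v) M ` \<V> \<Longrightarrow> cinner z u = 0"
    and split: "\<And>q. q \<in> range ((*v) W) \<Longrightarrow> \<exists>u\<in>(*v) M ` \<V>. \<exists>z\<in>Z. q = u + z"
    and rest: "harmonic_ritz_values A \<sigma> K - image_mset (\<lambda>i. ritz_of \<sigma> (\<mu> i)) (mset_set {1..k}) =
      image_mset (\<lambda>e. ritz_of \<sigma> (ev e)) (mset_set E)"
  proof -
    show thesis
      by (rule ritz_remainder[OF finite_atLeastAtMost inj_w ind_w \<mu>(1) \<mu>(2), unfolded U];
          (assumption | (rule that; assumption)))
  qed
  have subU: "vec.subspace ((*v) M ` \<V>)" unfolding U[symmetric] by (rule vec.subspace_span)
  have finE: "finite E" using E by (simp add: orthogonal_basis_def)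
  have "image_mset \<theta> (mset_set {1..k}) = image_mset (\<lambda>i. ritz_of \<sigma> (\<mu> i)) (mset_set {1..k})"
    using \<mu>(3) by (intro image_mset_cong) simp
  then have \<delta>: "\<delta> = ritz_gap lam \<sigma> (image_mset (\<lambda>e. ritz_of \<sigma> (ev e)) (mset_set E))"
    using assms(15) rest by simp
  have finD: "finite D" using finite_spectrum_hermitian[OF assms(1)] by (simp add: D_def)
  have "Min D \<in> D" using finD assms(2) by (intro Min_in) (auto simp: D_def)
  then have lo: "Min D > 0" using assms(3) by (auto simp: D_def)
  have hi: "Max D \<ge> 0" using lo finD assms(2) Min_le[OF finD] Max_ge[OF finD, of "Min D"] \<open>Min D \<in> D\<close> by linarith
  have \<kappa>: "shifted_cond A \<sigma> = Max D / Min D" by (simp add: shifted_cond_def D_def)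
  have "sin (subspace_angle ?X \<V>) \<le> shifted_cond A \<sigma> * sqrt (1 + r) * sin (vector_angle x y)"
    if x: "x \<in> ?X" "x \<noteq> 0" and y: "y \<in> \<K>" "y \<noteq> 0" for x y
  proof -
    have Mx: "M *v x = h *s x"
      using x by (simp add: eigenspace_def shifted_mult_vec h_def vec.scale_left_diff_distrib)
    have "(1 / h) *s (C *v (M *v x)) = C *v x" unfolding Mx vec.scale using h by simp
    then have Cx: "C *v x = (1 / h) *s x" by simp
    obtain a where a: "norm (x - a *s y) = sin (vector_angle x y) * norm x"
      using sin_vector_angle_projection(1)[OF x(2) y(2)] by blast
    \<comment> \<open>\<open>a *s y\<close> is the point nearest to \<open>x\<close> on the line of
      \<open>y\<close>. Its image under \<open>M\<close> is divided by \<open>h\<close> because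
      \<open>M *v x = h *s x\<close>, so that \<open>x - q\<close> is the image of
      \<open>x - a *s y\<close> divided by \<open>h\<close>.\<close>
    define q where "q = (a / h) *s (M *v y)"
    have q: "q \<in> range ((*v) W)"
      unfolding q_def Q assms(12) vec.scale[symmetric]
      using assms(4) y(1) by (intro imageI vec.subspace_scale)
    have "x - q = (1 / h) *s (M *v (x - a *s y))"
      using h by (simp add: q_def matrix_vector_mult_diff_distrib Mx vec.scale vec.scale_right_diff_distrib)
    then have "norm (x - q) = norm (M *v (x - a *s y)) / cmod h" by (simp add: norm_scale norm_divide)
    also have "\<dots> \<le> Max D * norm (x - a *s y) / cmod h"
      using shifted_norm_bounds(2)[OF assms(1), of \<sigma>] by (intro divide_right_mono) (auto simp: D_def)
    finally have xq: "norm (x - q) \<le> Max D * norm (x - a *s y) / cmod h" .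
    \<comment> \<open>\<open>P *v x\<close> is the best approximation of \<open>x\<close> in the
      range of \<open>W\<close>, so it is at least as close as \<open>q\<close>.\<close>
    have "P *v x - q \<in> range ((*v) W)"
      using P_in_range q by (metis range_eq_span_columns vec.span_diff)
    then have "cinner (x - P *v x) (P *v x - q) = 0" by (rule P_residual_orthogonal)
    from pythagoras[OF this] have "(norm (x - P *v x))\<^sup>2 \<le> (norm (x - q))\<^sup>2" by simp
    then have "norm (x - P *v x) \<le> norm (x - q)" by (rule power2_le_imp_le) simp
    note xP = order_trans[OF this xq]
    obtain u z where uz: "P *v x = u + z" "u \<in> (*v) M ` \<V>" "z \<in> Z"
      using split[OF P_in_range] by blast
    have bound: "d * norm z \<le> \<gamma> * norm (x - P *v x)"
      if "0 \<le> d" "\<And>e. e \<in> E \<Longrightarrow> d \<le> cmod (ev e - 1 / h)" for d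
      unfolding assms(14)
      using that Z(2) by (intro ritz_complement_bound[OF P_idem E Z(1) subU ev ZB UB UZ P_fixes Cx uz]) auto
    have "(norm z)\<^sup>2 \<le> r * (norm (x - P *v x))\<^sup>2"
      unfolding r_def
    proof (rule ritz_gap_bound[OF finE _ _ \<delta> assms(16) bound])
      show "gap_term lam \<sigma> (ritz_of \<sigma> (ev e)) = cmod (ev e - 1 / h)" for e
        using gap_term_ritz_of[OF lam] by (simp add: h_def)
      show "norm z = 0" if "E = {}" using that E uz(3) by (auto simp: orthogonal_basis_def)
    qed auto
    moreover have "cinner (x - P *v x) z = 0" using uz(3) Z(2) by (intro P_residual_orthogonal) auto
    then have "(norm (x - u))\<^sup>2 = (norm (x - P *v x))\<^sup>2 + (norm z)\<^sup>2"
      using pythagoras[of "x - P *v x" z] by (simp add: uz(1))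
    ultimately have "(norm (x - u))\<^sup>2 \<le> (1 + r) * (norm (x - P *v x))\<^sup>2" by (simp add: algebra_simps)
    then have xu: "norm (x - u) \<le> sqrt (1 + r) * norm (x - P *v x)"
      using real_sqrt_le_mono by (fastforce simp: real_sqrt_mult)
    obtain v' where v': "v' \<in> \<V>" "u = M *v v'" using uz(2) by blast
    \<comment> \<open>\<open>h *s v'\<close> is the approximant of \<open>x\<close> in
      \<open>\<V>\<close>: applying \<open>M\<close> to the error \<open>x - h *s v'\<close> gives
      \<open>h *s (x - u)\<close>.\<close>
    have hv: "h *s v' \<in> \<V>" using v'(1) unfolding assms(11) by (rule vec.span_scale)
    have "Min D * norm (x - h *s v') \<le> norm (M *v (x - h *s v'))"
      using shifted_norm_bounds(1)[OF assms(1), of \<sigma>] by (simp add: D_def)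
    also have "M *v (x - h *s v') = h *s (x - u)"
      by (simp add: matrix_vector_mult_diff_distrib Mx v'(2) vec.scale vec.scale_right_diff_distrib)
    also have "norm \<dots> = cmod h * norm (x - u)" by (rule norm_scale)
    \<comment> \<open>The division by \<open>cmod h\<close> from the passage to \<open>\<Q>\<close>
      cancels against the factor \<open>cmod h\<close> of the way back, leaving only
      \<open>Max D\<close> and \<open>Min D\<close>.\<close>
    also have "\<dots> \<le> cmod h * (sqrt (1 + r) * (Max D * norm (x - a *s y) / cmod h))"
      using xP by (intro mult_left_mono order_trans[OF xu] mult_left_mono) (use r in auto)
    also have "\<dots> = Max D * sqrt (1 + r) * norm (x - a *s y)" using h by simp
    finally have "norm (x - h *s v') \<le> Max D * sqrt (1 + r) * norm (x - a *s y) / Min D"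
      using lo by (simp add: pos_le_divide_eq mult.commute)
    then have "sin (subspace_angle ?X \<V>) * norm x \<le> Max D * sqrt (1 + r) * norm (x - a *s y) / Min D"
      using sin_subspace_angle_le[OF x hv] by linarith
    then have "sin (subspace_angle ?X \<V>) * norm x \<le>
        (shifted_cond A \<sigma> * sqrt (1 + r) * sin (vector_angle x y)) * norm x"
      unfolding a \<kappa> by simp
    then show ?thesis using x(2) by simp
  qed
  moreover obtain x0 where "x0 \<in> ?X" "x0 \<noteq> 0"
    using assms(2) by (auto simp: spectrum_def eigenspace_def)
  moreover obtain y0 where "y0 \<in> \<K>" "y0 \<noteq> 0"
    using assms(5) vec.subspace_0[OF assms(4)] by blast
  ultimately show ?thesis
    unfolding r_def[symmetric] by (intro sin_subspace_angle_ge)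
qed

end
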